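(* Let $P$ be a conditional mean on a hyper-Archimedean vector lattice $V$. Then $P$ has a canonical extension for which $P(\cdot|v)$ is a positive linear functional defined on the entire space $V$ for every $v\in V^+$, $v\neq 0$. Moreover, $P(\mathbf 1_A|\mathbf 1_B)=P(\mathbf 1_{A\cap B}|\mathbf 1_B)$ holds for arbitrary non-empty subsets $A,B\subseteq X$ when $V$ is the space of step-functions on a set $X$.
   Context: A vector lattice is an ordered real vector space in which any two elements $u,v$ have a minimum $u\wedge v$ and a maximum $u\vee v$; $V^+$ is its positive cone. An ordered vector space is Archimedean if the set $\{nv:n\in\mathbf N\}$ does not admit an upper bound unless $v\leq 0$. A vector lattice is hyper-Archimedean if all its quotient vector lattices are Archimedean. A step-function on a set $X$ is a real function on $X$ taking only finitely many values; $\mathbf 1_A$ is the indicator function of $A$. A conditional mean on $V$ is a function $P$ with values in $[0,1]$ defined on all pairs $0\leq u\leq v\neq 0$ in $V$ (value $P(u|v)$) such that: (CM1) $P(u+v|w)=P(u|w)+P(v|w)$ when $u,v\geq 0$, $u+v\leq w\neq 0$; (CM2) $P(u|w)=P(u|v)P(v|w)$ when $0\leq u\leq v\leq w$, $v\neq 0$; (CM3) $P(u|u)=1$ when $u\geq 0$, $u\neq 0$. An extension of $P$ means real values $P(u|v)$ for all $u\in V$ and $v\in V^+\smallsetminus\{0\}$ agreeing with the given values when $0\leq u\leq v$; in the step-function identity, $P$ denotes this extension. A linear functional is positive if it is non-negative on $V^+$. *)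

theory Defs
  imports Complex_Main "HOL-Library.Lattice_Algebras"
begin

section \<open>Vector lattices\<close>

text \<open>The class \<^class>\<open>lattice_ab_group_add_abs\<close> only adds the definitional axiom
  \<open>\<bar>u\<bar> = sup u (- u)\<close>.\<close>

class vector_lattice = ordered_real_vector + lattice_ab_group_add_abs

definition positive_functional :: "('a::vector_lattice \<Rightarrow> real) \<Rightarrow> bool" where
  "positive_functional f \<longleftrightarrow> linear f \<and> (\<forall>u\<ge>0. 0 \<le> f u)"


section \<open>Quotients and the hyper-Archimedean property\<close>

text \<open>Quotients of a vector lattice are sets of cosets, so the Archimedean property is stated for
  an ordered vector space with explicit carrier, scalar multiplication, zero and order.\<close>

definition archimedean_on ::
    "'b set \<Rightarrow> (real \<Rightarrow> 'b \<Rightarrow> 'b) \<Rightarrow> 'b \<Rightarrow> ('b \<Rightarrow> 'b \<Rightarrow> bool) \<Rightarrow> bool" where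
  "archimedean_on W scale zero le \<longleftrightarrow>
     (\<forall>v\<in>W. (\<exists>b\<in>W. \<forall>n::nat. le (scale (real n) v) b) \<longrightarrow> le v zero)"

definition lattice_ideal :: "'a::vector_lattice set \<Rightarrow> bool" where
  "lattice_ideal I \<longleftrightarrow> subspace I \<and> (\<forall>u v. v \<in> I \<and> \<bar>u\<bar> \<le> \<bar>v\<bar> \<longrightarrow> u \<in> I)"

definition ideal_rel :: "'a::vector_lattice set \<Rightarrow> ('a \<times> 'a) set" where
  "ideal_rel I = {(u, v). u - v \<in> I}"

definition quot_carrier :: "'a::vector_lattice set \<Rightarrow> 'a set set" where
  "quot_carrier I = UNIV // ideal_rel I"

definition quot_scale :: "'a::vector_lattice set \<Rightarrow> real \<Rightarrow> 'a set \<Rightarrow> 'a set" where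
  "quot_scale I r C = (\<Union>u\<in>C. ideal_rel I `` {r *\<^sub>R u})"

definition quot_zero :: "'a::vector_lattice set \<Rightarrow> 'a set" where
  "quot_zero I = ideal_rel I `` {0}"

definition quot_le :: "'a::vector_lattice set \<Rightarrow> 'a set \<Rightarrow> bool" where
  "quot_le C D \<longleftrightarrow> (\<exists>u\<in>C. \<exists>v\<in>D. u \<le> v)"

definition hyper_archimedean :: "'a::vector_lattice itself \<Rightarrow> bool" where
  "hyper_archimedean _ \<longleftrightarrow>
     (\<forall>I :: 'a set. lattice_ideal I \<longrightarrow>
        archimedean_on (quot_carrier I) (quot_scale I) (quot_zero I) quot_le)"


section \<open>Conditional means\<close>

text \<open>A conditional mean is a total function here, but only its values \<open>P u v\<close> with
  \<open>0 \<le> u \<le> v \<noteq> 0\<close> are constrained or used.\<close>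

definition conditional_mean :: "('a::vector_lattice \<Rightarrow> 'a \<Rightarrow> real) \<Rightarrow> bool" where
  "conditional_mean P \<longleftrightarrow>
     (\<forall>u v. 0 \<le> u \<and> u \<le> v \<and> v \<noteq> 0 \<longrightarrow> 0 \<le> P u v \<and> P u v \<le> 1) \<and>
     (\<forall>u v w. 0 \<le> u \<and> 0 \<le> v \<and> u + v \<le> w \<and> w \<noteq> 0 \<longrightarrow> P (u + v) w = P u w + P v w) \<and>
     (\<forall>u v w. 0 \<le> u \<and> u \<le> v \<and> v \<le> w \<and> v \<noteq> 0 \<longrightarrow> P u w = P u v * P v w) \<and>
     (\<forall>u. 0 \<le> u \<and> u \<noteq> 0 \<longrightarrow> P u u = 1)"

text \<open>The values on \<open>{0..v}\<close> determine a linear functional only on the ideal generated by \<open>v\<close>.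
  The canonical choice on all of the space is the positive functional that moreover vanishes on
  the elements disjoint from \<open>v\<close>.\<close>

definition canonical_functional ::
    "('a::vector_lattice \<Rightarrow> 'a \<Rightarrow> real) \<Rightarrow> 'a \<Rightarrow> ('a \<Rightarrow> real) \<Rightarrow> bool" where
  "canonical_functional P v f \<longleftrightarrow>
     positive_functional f \<and>
     (\<forall>u. 0 \<le> u \<and> u \<le> v \<longrightarrow> f u = P u v) \<and>
     (\<forall>u. inf \<bar>u\<bar> v = 0 \<longrightarrow> f u = 0)"

definition canonical_extension ::
    "('a::vector_lattice \<Rightarrow> 'a \<Rightarrow> real) \<Rightarrow> 'a \<Rightarrow> 'a \<Rightarrow> real" where
  "canonical_extension P u v = (THE f. canonical_functional P v f) u"


section \<open>Step-functions\<close>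

text \<open>The underlying set \<open>X\<close> is the universe of the type \<open>'x\<close>.\<close>

typedef 'x step_fun = "{f :: 'x \<Rightarrow> real. finite (range f)}"
  morphisms step_apply Step_fun
  by (rule exI[of _ "\<lambda>_. 0"]) simp

setup_lifting type_definition_step_fun

lemma finite_range_comp2:
  assumes "finite (range f)" "finite (range g)"
  shows "finite (range (\<lambda>x. h (f x) (g x)))"
proof (rule finite_subset)
  show "range (\<lambda>x. h (f x) (g x)) \<subseteq> (\<lambda>(a, b). h a b) ` (range f \<times> range g)"
    by auto
qed (use assms in auto)

lemma finite_range_comp1: "finite (range f) \<Longrightarrow> finite (range (\<lambda>x. h (f x)))"
  using finite_range_comp2[of f f "\<lambda>a _. h a"] by simp

instantiation step_fun :: (type) vector_lattice
begin

lift_definition zero_step_fun :: "'a step_fun" is "\<lambda>_. 0" by simp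
lift_definition plus_step_fun :: "'a step_fun \<Rightarrow> 'a step_fun \<Rightarrow> 'a step_fun"
  is "\<lambda>f g x. f x + g x" by (rule finite_range_comp2)
lift_definition minus_step_fun :: "'a step_fun \<Rightarrow> 'a step_fun \<Rightarrow> 'a step_fun"
  is "\<lambda>f g x. f x - g x" by (rule finite_range_comp2)
lift_definition uminus_step_fun :: "'a step_fun \<Rightarrow> 'a step_fun"
  is "\<lambda>f x. - f x" by (rule finite_range_comp1)
lift_definition scaleR_step_fun :: "real \<Rightarrow> 'a step_fun \<Rightarrow> 'a step_fun"
  is "\<lambda>r f x. r * f x" by (rule finite_range_comp1)
lift_definition less_eq_step_fun :: "'a step_fun \<Rightarrow> 'a step_fun \<Rightarrow> bool"
  is "\<lambda>f g. \<forall>x. f x \<le> g x" .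
definition less_step_fun :: "'a step_fun \<Rightarrow> 'a step_fun \<Rightarrow> bool" where
  "less_step_fun f g \<longleftrightarrow> f \<le> g \<and> \<not> g \<le> f"
lift_definition inf_step_fun :: "'a step_fun \<Rightarrow> 'a step_fun \<Rightarrow> 'a step_fun"
  is "\<lambda>f g x. min (f x) (g x)" by (rule finite_range_comp2)
lift_definition sup_step_fun :: "'a step_fun \<Rightarrow> 'a step_fun \<Rightarrow> 'a step_fun"
  is "\<lambda>f g x. max (f x) (g x)" by (rule finite_range_comp2)
lift_definition abs_step_fun :: "'a step_fun \<Rightarrow> 'a step_fun"
  is "\<lambda>f x. \<bar>f x\<bar>" by (rule finite_range_comp1)

instance
proof
  fix a b c :: "'a step_fun" and r s :: real
  show "a + b + c = a + (b + c)" by transfer (simp add: add.assoc)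
  show "a + b = b + a" by transfer (simp add: add.commute)
  show "0 + a = a" by transfer simp
  show "- a + a = 0" by transfer simp
  show "a - b = a + - b" by transfer simp
  show "r *\<^sub>R (a + b) = r *\<^sub>R a + r *\<^sub>R b" by transfer (simp add: distrib_left)
  show "(r + s) *\<^sub>R a = r *\<^sub>R a + s *\<^sub>R a" by transfer (simp add: distrib_right)
  show "r *\<^sub>R s *\<^sub>R a = (r * s) *\<^sub>R a" by transfer (simp add: mult.assoc)
  show "1 *\<^sub>R a = a" by transfer simp
  show "(a < b) = (a \<le> b \<and> \<not> b \<le> a)" by (rule less_step_fun_def)
  show "a \<le> a" by transfer simp
  show "a \<le> b \<Longrightarrow> b \<le> c \<Longrightarrow> a \<le> c" by transfer (blast intro: order_trans)
  show "a \<le> b \<Longrightarrow> b \<le> a \<Longrightarrow> a = b" by transfer (auto intro: antisym)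
  show "a \<le> b \<Longrightarrow> c + a \<le> c + b" by transfer simp
  show "a \<le> b \<Longrightarrow> 0 \<le> r \<Longrightarrow> r *\<^sub>R a \<le> r *\<^sub>R b" by transfer (simp add: mult_left_mono)
  show "r \<le> s \<Longrightarrow> 0 \<le> a \<Longrightarrow> r *\<^sub>R a \<le> s *\<^sub>R a" by transfer (simp add: mult_right_mono)
  show "inf a b \<le> a" "inf a b \<le> b" by (transfer; simp)+
  show "a \<le> b \<Longrightarrow> a \<le> c \<Longrightarrow> a \<le> inf b c" by transfer simp
  show "a \<le> sup a b" "b \<le> sup a b" by (transfer; simp)+
  show "b \<le> a \<Longrightarrow> c \<le> a \<Longrightarrow> sup b c \<le> a" by transfer simp
  show "\<bar>a\<bar> = sup a (- a)" by transfer (auto simp: fun_eq_iff abs_if max_def)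
qed

end

lift_definition step_indicator :: "'x set \<Rightarrow> 'x step_fun" is "\<lambda>A x. if x \<in> A then 1 else 0"
proof -
  fix A :: "'x set"
  show "finite (range (\<lambda>x. if x \<in> A then 1 else 0 :: real))"
    by (rule finite_subset[of _ "{0, 1}"]) auto
qed

text \<open>Step-functions form a hyper-Archimedean space, so conditional means on them have canonical
  extensions.\<close>

lemma quot_le_iff:
  assumes "lattice_ideal I"
  shows "quot_le (ideal_rel I `` {u}) (ideal_rel I `` {v}) \<longleftrightarrow> (\<exists>i\<in>I. u \<le> v + i)"
proof
  assume "quot_le (ideal_rel I `` {u}) (ideal_rel I `` {v})"
  then obtain a b where ab: "u - a \<in> I" "v - b \<in> I" "a \<le> b"
    by (auto simp: quot_le_def ideal_rel_def)
  have "(u - a) - (v - b) \<in> I"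
    using ab assms by (auto simp: lattice_ideal_def intro: subspace_diff)
  moreover have "u \<le> v + ((u - a) - (v - b))"
    using ab(3) by (simp add: algebra_simps)
  ultimately show "\<exists>i\<in>I. u \<le> v + i" by blast
next
  assume "\<exists>i\<in>I. u \<le> v + i"
  then obtain i where i: "i \<in> I" "u \<le> v + i" by blast
  have "0 \<in> I" "- i \<in> I"
    using assms i by (auto simp: lattice_ideal_def intro: subspace_0 subspace_neg)
  then show "quot_le (ideal_rel I `` {u}) (ideal_rel I `` {v})"
    using i(2) unfolding quot_le_def ideal_rel_def
    by (intro bexI[of _ u] bexI[of _ "v + i"]) auto
qed

lemma quot_scale_class:
  assumes "lattice_ideal I"
  shows "quot_scale I r (ideal_rel I `` {u}) = ideal_rel I `` {r *\<^sub>R u}"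
proof -
  have sub: "subspace I" using assms by (simp add: lattice_ideal_def)
  have "w \<in> ideal_rel I `` {r *\<^sub>R u}" if "u - a \<in> I" "r *\<^sub>R a - w \<in> I" for a w
  proof -
    have "r *\<^sub>R (u - a) + (r *\<^sub>R a - w) \<in> I"
      using sub that by (intro subspace_add subspace_scale)
    then show ?thesis by (simp add: ideal_rel_def algebra_simps)
  qed
  moreover have "u \<in> ideal_rel I `` {u}"
    using sub by (simp add: ideal_rel_def subspace_0)
  ultimately show ?thesis
    unfolding quot_scale_def by (auto simp: ideal_rel_def intro!: exI[of _ u])
qed

lemma hyper_archimedean_step_fun: "hyper_archimedean TYPE('x step_fun)"
  unfolding hyper_archimedean_def archimedean_on_def
proof (intro allI impI ballI)
  fix I :: "'x step_fun set" and C
  assume I: "lattice_ideal I" and "C \<in> quot_carrier I"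
    and "\<exists>D\<in>quot_carrier I. \<forall>n::nat. quot_le (quot_scale I (real n) C) D"
  then obtain v b where C: "C = ideal_rel I `` {v}"
    and "\<And>n::nat. quot_le (quot_scale I (real n) C) (ideal_rel I `` {b})"
    by (auto simp: quot_carrier_def quotient_def)
  then have bound: "\<exists>i\<in>I. real n *\<^sub>R v \<le> b + i" for n
    using I by (simp add: quot_scale_class quot_le_iff)
  have "finite (range (step_apply v))" "finite (range (step_apply b))"
    using step_apply by auto
  note fin = this
  define e where "e = Min (insert 1 {t \<in> range (step_apply v). 0 < t})"
  define m where "m = Max (range (step_apply b))"
  have e: "e > 0" "step_apply v x > 0 \<Longrightarrow> e \<le> step_apply v x" for x
    using fin by (auto simp: e_def)
  have m: "step_apply b x \<le> m" for x
    using fin by (auto simp: m_def)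
  obtain n where n: "real n * e > m + 1"
    using e(1) reals_Archimedean3 by blast
  obtain i where i: "i \<in> I" and "real n *\<^sub>R v \<le> b + i"
    using bound by blast
  then have le: "real n * step_apply v x \<le> step_apply b x + step_apply i x" for x
    by transfer simp
  define p where "p = step_indicator {x. 0 < step_apply v x}"
  have "\<bar>step_apply p x\<bar> \<le> \<bar>step_apply i x\<bar>" for x
  proof (cases "0 < step_apply v x")
    case True
    have "real n * e \<le> real n * step_apply v x"
      using e(2)[OF True] by (intro mult_left_mono) auto
    then have "1 \<le> step_apply i x" using le[of x] m[of x] n by linarith
    then show ?thesis using True by (simp add: p_def step_indicator.rep_eq)
  next
    case False
    then show ?thesis by (simp add: p_def step_indicator.rep_eq)
  qed
  then have "\<bar>p\<bar> \<le> \<bar>i\<bar>" by (simp add: less_eq_step_fun.rep_eq abs_step_fun.rep_eq)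
  then have "p \<in> I" using I i by (auto simp: lattice_ideal_def)
  define k where "k = Max (range (step_apply v))"
  have k: "step_apply v x \<le> k" for x
    using fin by (auto simp: k_def)
  have "k *\<^sub>R p \<in> I" using \<open>p \<in> I\<close> I by (auto simp: lattice_ideal_def intro: subspace_scale)
  moreover have "v \<le> 0 + k *\<^sub>R p"
    using k by (auto simp: less_eq_step_fun.rep_eq plus_step_fun.rep_eq zero_step_fun.rep_eq
        scaleR_step_fun.rep_eq p_def step_indicator.rep_eq)
  ultimately show "quot_le C (quot_zero I)"
    using I by (auto simp: C quot_zero_def quot_le_iff)
qed

end

theory Submission
  imports Defs
begin

text \<open>
  Let \<open>v \<ge> 0\<close>. If \<open>I\<close> is the ideal generated by the elements \<open>(n v - u)\<^sup>+\<close>, then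
  \<open>n v \<le> u\<close> modulo \<open>I\<close> for every \<open>n\<close>, so the Archimedean property of the quotient by \<open>I\<close>
  gives \<open>v \<in> I\<close>, that is \<open>v \<le> k (n v - u)\<^sup>+\<close> for some \<open>k\<close> and \<open>n\<close>. Hence
  \<open>(u - n v)\<^sup>+\<close> is disjoint from \<open>v\<close>, and \<open>u \<ge> 0\<close> splits as a part below \<open>n v\<close> plus a part
  disjoint from \<open>v\<close>. The values of \<open>P(\<cdot>|v)\<close> on the order interval from \<open>0\<close> to \<open>v\<close>
  therefore determine an additive function on the positive cone that vanishes on the elements
  disjoint from \<open>v\<close>, and such a function extends uniquely to a positive linear functional.
\<close>

section \<open>Disjointness in vector lattices\<close>

text \<open>The infimum \<open>?z\<close> is peeled in two stages: \<open>?z - b\<close> lies below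
  both \<open>a\<close> and \<open>c\<close>, hence below \<open>inf a c\<close>; then
  \<open>?z - inf a c\<close> lies below both \<open>b\<close> and \<open>c\<close>.\<close>

lemma inf_add_le:
  fixes a b c :: "'a::vector_lattice"
  assumes "0 \<le> a" "0 \<le> b" "0 \<le> c"
  shows "inf (a + b) c \<le> inf a c + inf b c"
proof -
  let ?z = "inf (a + b) c"
  have "?z - b \<le> c"
    using assms(2) by (meson diff_le_eq inf_le2 le_add_same_cancel1 order_trans)
  moreover have "?z - b \<le> a"
    by (simp add: diff_le_eq)
  ultimately have "?z - b \<le> inf a c"
    by simp
  then have "?z - inf a c \<le> b"
    by (metis add.commute diff_le_eq)
  moreover have "0 \<le> inf a c"
    using assms by simp
  then have "?z - inf a c \<le> c"
    by (metis diff_le_eq inf_le2 le_add_same_cancel1 order_trans)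
  ultimately have "?z - inf a c \<le> inf b c"
    by simp
  then show ?thesis
    by (metis add.commute diff_le_eq)
qed

lemma disjoint_add:
  fixes a b c :: "'a::vector_lattice"
  assumes "0 \<le> a" "0 \<le> b" "0 \<le> c" "inf a c = 0" "inf b c = 0"
  shows "inf (a + b) c = 0"
  using inf_add_le[OF assms(1-3)] assms by (intro antisym) auto

lemma disjoint_mono:
  fixes b c :: "'a::vector_lattice"
  assumes "inf b c = 0" "0 \<le> a" "a \<le> c" "0 \<le> b"
  shows "inf b a = 0"
  using assms by (metis antisym inf_greatest inf_mono order_refl)

text \<open>Induction with \<open>disjoint_add\<close> handles natural multiples of
  \<open>c\<close>; a real multiple lies below a natural one.\<close>

lemma disjoint_scaleR:
  fixes b c :: "'a::vector_lattice"
  assumes "0 \<le> b" "0 \<le> c" "inf b c = 0" "0 \<le> r"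
  shows "inf b (r *\<^sub>R c) = 0"
proof -
  obtain n :: nat where n: "r \<le> real n"
    using real_arch_simple by blast
  have "inf (real m *\<^sub>R c) b = 0" for m :: nat
  proof (induction m)
    case 0
    then show ?case using assms(1) by (simp add: inf_absorb1)
  next
    case (Suc m)
    then show ?case
      using assms disjoint_add[of "real m *\<^sub>R c" c b]
      by (simp add: scaleR_left_distrib inf_commute scaleR_nonneg_nonneg add.commute)
  qed
  then show ?thesis
    using disjoint_mono[of b "real n *\<^sub>R c" "r *\<^sub>R c"] n assms
    by (simp add: inf_commute scaleR_right_mono scaleR_nonneg_nonneg)
qed

lemma sup_0_minus_eq:
  fixes w :: "'a::vector_lattice"
  shows "sup w 0 - sup (- w) 0 = w"
proof -
  have "sup w 0 + inf w 0 = w"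
    using prts[of w] by (simp add: pprt_def nprt_def)
  moreover have "inf w 0 = - sup (- w) 0"
    by simp
  ultimately show ?thesis
    by (metis diff_conv_add_uminus)
qed

text \<open>Infima commute with translations: taking out the negative part leaves
  \<open>inf w 0\<close>, which is its negative.\<close>

lemma disjoint_pos_neg_part:
  fixes w :: "'a::vector_lattice"
  shows "inf (sup w 0) (sup (- w) 0) = 0"
proof -
  let ?q = "sup (- w) 0"
  have "sup w 0 = w + ?q"
    using sup_0_minus_eq[of w] by (metis diff_add_cancel)
  then have "inf (sup w 0) ?q = inf (w + ?q) (0 + ?q)"
    by (simp only: add_0)
  also have "\<dots> = inf w 0 + ?q"
    by (simp only: add_inf_distrib_right)
  also have "inf w 0 = - ?q"
    by simp
  finally show ?thesis
    by (simp only: ab_left_minus)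
qed

lemma abs_scaleR_le:
  fixes u :: "'a::vector_lattice"
  shows "\<bar>r *\<^sub>R u\<bar> \<le> \<bar>r\<bar> *\<^sub>R \<bar>u\<bar>"
proof -
  have le: "s *\<^sub>R u \<le> \<bar>s\<bar> *\<^sub>R \<bar>u\<bar>" for s
  proof (cases "0 \<le> s")
    case True
    then show ?thesis by (simp add: scaleR_left_mono abs_ge_self)
  next
    case False
    then have "(- s) *\<^sub>R (- u) \<le> (- s) *\<^sub>R \<bar>u\<bar>"
      by (intro scaleR_left_mono) (auto simp: abs_ge_minus_self)
    then show ?thesis using False by simp
  qed
  show ?thesis
    using le[of r] le[of "- r"] by (intro abs_leI) auto
qed

section \<open>Hyper-Archimedean vector lattices\<close>

text \<open>Monotonicity of \<open>p\<close> lets two elements be bounded by multiples of one common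
  term, so the bounds need no sums of different terms.\<close>

lemma lattice_ideal_incseq:
  fixes p :: "nat \<Rightarrow> 'a::vector_lattice"
  assumes "incseq p" "\<And>n. 0 \<le> p n"
  shows "lattice_ideal {w. \<exists>n k. 0 \<le> k \<and> \<bar>w\<bar> \<le> k *\<^sub>R p n}" (is "lattice_ideal ?I")
  unfolding lattice_ideal_def
proof (intro conjI allI impI)
  show "subspace ?I"
  proof (rule subspaceI)
    show "0 \<in> ?I"
      by (intro CollectI exI[of _ "0::nat"] exI[of _ "0::real"]) simp
  next
    fix x y assume "x \<in> ?I" "y \<in> ?I"
    then obtain n k m l where *: "0 \<le> k" "\<bar>x\<bar> \<le> k *\<^sub>R p n" "0 \<le> l" "\<bar>y\<bar> \<le> l *\<^sub>R p m"
      by blast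
    have "\<bar>x + y\<bar> \<le> \<bar>x\<bar> + \<bar>y\<bar>"
      by (rule abs_triangle_ineq)
    also have "\<dots> \<le> k *\<^sub>R p n + l *\<^sub>R p m"
      using * by (intro add_mono)
    also have "\<dots> \<le> k *\<^sub>R p (max n m) + l *\<^sub>R p (max n m)"
      using * assms(1) by (intro add_mono scaleR_left_mono) (auto simp: incseq_def)
    finally have "\<bar>x + y\<bar> \<le> (k + l) *\<^sub>R p (max n m)"
      by (simp add: scaleR_left_distrib)
    then show "x + y \<in> ?I"
      using * by (intro CollectI exI conjI) auto
  next
    fix c :: real and x assume "x \<in> ?I"
    then obtain n k where *: "0 \<le> k" "\<bar>x\<bar> \<le> k *\<^sub>R p n"
      by blast
    have "\<bar>c *\<^sub>R x\<bar> \<le> \<bar>c\<bar> *\<^sub>R \<bar>x\<bar>"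
      by (rule abs_scaleR_le)
    also have "\<dots> \<le> \<bar>c\<bar> *\<^sub>R (k *\<^sub>R p n)"
      using * by (intro scaleR_left_mono) auto
    finally have "\<bar>c *\<^sub>R x\<bar> \<le> (\<bar>c\<bar> * k) *\<^sub>R p n"
      by simp
    then show "c *\<^sub>R x \<in> ?I"
      using * by (intro CollectI exI conjI) auto
  qed
next
  fix u v assume "v \<in> ?I \<and> \<bar>u\<bar> \<le> \<bar>v\<bar>"
  then show "u \<in> ?I"
    using order_trans by blast
qed

text \<open>A band decomposition of \<open>u\<close> along \<open>v\<close>: \<open>a\<close> lies
  in the ideal generated by \<open>v\<close>, \<open>b\<close> in its disjoint complement. The index
  \<open>n\<close> is recorded because \<open>a\<close> will be rescaled by \<open>1 / n\<close>
  into the interval from 0 to \<open>v\<close>; hence \<open>0 < n\<close>.\<close>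

definition splitting :: "'a::vector_lattice \<Rightarrow> 'a \<Rightarrow> nat \<Rightarrow> 'a \<Rightarrow> 'a \<Rightarrow> bool" where
  "splitting v u n a b \<longleftrightarrow>
     u = a + b \<and> 0 < n \<and> 0 \<le> a \<and> a \<le> real n *\<^sub>R v \<and> 0 \<le> b \<and> inf b v = 0"

lemma splitting_exists:
  fixes u v :: "'a::vector_lattice"
  assumes hyp: "hyper_archimedean TYPE('a)" and u: "0 \<le> u" and v: "0 \<le> v"
  obtains n a b where "splitting v u n a b"
proof -
  define p where "p n = sup (real n *\<^sub>R v - u) 0" for n :: nat
  define I where "I = {w. \<exists>n k. 0 \<le> k \<and> \<bar>w\<bar> \<le> k *\<^sub>R p n}"
  have p_mono: "incseq p"
    unfolding p_def incseq_def
    using v by (auto intro!: le_supI1 diff_right_mono scaleR_right_mono)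
  have p_nonneg: "0 \<le> p n" for n
    by (simp add: p_def)
  have I: "lattice_ideal I"
    unfolding I_def by (rule lattice_ideal_incseq[OF p_mono p_nonneg])
  have bound: "\<exists>i\<in>I. real n *\<^sub>R v \<le> u + i" for n
  proof
    show "p n \<in> I"
      unfolding I_def using p_nonneg by (intro CollectI exI[of _ n] exI[of _ 1]) auto
    have "real n *\<^sub>R v - u \<le> p n"
      by (simp add: p_def)
    then show "real n *\<^sub>R v \<le> u + p n"
      by (simp add: algebra_simps)
  qed
  have "archimedean_on (quot_carrier I) (quot_scale I) (quot_zero I) quot_le"
    using hyp I by (simp add: hyper_archimedean_def)
  moreover have "ideal_rel I `` {w} \<in> quot_carrier I" for w
    by (auto simp: quot_carrier_def quotient_def)
  moreover have "quot_le (quot_scale I (real n) (ideal_rel I `` {v})) (ideal_rel I `` {u})" for n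
    using bound I by (simp add: quot_scale_class quot_le_iff)
  ultimately have "quot_le (ideal_rel I `` {v}) (ideal_rel I `` {0})"
    unfolding archimedean_on_def quot_zero_def by blast
  then obtain i where "i \<in> I" "v \<le> i"
    using I by (auto simp: quot_le_iff)
  moreover from this obtain n k where "0 \<le> k" "\<bar>i\<bar> \<le> k *\<^sub>R p n"
    unfolding I_def by blast
  ultimately have k: "0 \<le> k" "v \<le> k *\<^sub>R p n"
    using abs_ge_self[of i] by auto
  \<comment> \<open>Passing to \<open>Suc n\<close> guarantees the positive index that
    \<open>splitting\<close> demands.\<close>
  have "k *\<^sub>R p n \<le> k *\<^sub>R p (Suc n)"
    using k p_mono by (intro scaleR_left_mono incseq_SucD)
  then have "v \<le> k *\<^sub>R p (Suc n)"
    using k by simp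
  \<comment> \<open>With this choice \<open>p (Suc n)\<close> is the negative part of the element
    whose positive part is \<open>b\<close>, so the two are disjoint.\<close>
  define b where "b = sup (u - real (Suc n) *\<^sub>R v) 0"
  have "inf b (p (Suc n)) = 0"
    using disjoint_pos_neg_part[of "u - real (Suc n) *\<^sub>R v"] unfolding b_def p_def by simp
  then have "inf b (k *\<^sub>R p (Suc n)) = 0"
    using k p_nonneg by (intro disjoint_scaleR) (auto simp: b_def)
  then have "inf b v = 0"
    using v \<open>v \<le> k *\<^sub>R p (Suc n)\<close> by (rule disjoint_mono) (simp add: b_def)
  moreover have "b \<le> u"
    using u v by (simp add: b_def scaleR_nonneg_nonneg del: of_nat_Suc)
  moreover have "u - real (Suc n) *\<^sub>R v \<le> b"
    by (simp add: b_def)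
  then have "u - b \<le> real (Suc n) *\<^sub>R v"
    by (simp add: algebra_simps)
  moreover have "0 \<le> b"
    by (simp add: b_def)
  ultimately have "splitting v u (Suc n) (u - b) b"
    unfolding splitting_def by (auto simp del: of_nat_Suc)
  then show thesis
    by (rule that)
qed

text \<open>Since \<open>d\<close> is disjoint from \<open>v\<close>, it is disjoint from the
  multiple of \<open>v\<close> that dominates \<open>a\<close>, hence from \<open>a\<close>. So
  \<open>a\<close>, being below \<open>c + d\<close>, must already be below \<open>c\<close>.
  Exchanging the two splittings, whose indices may differ, gives uniqueness.\<close>

lemma splitting_le:
  fixes v :: "'a::vector_lattice"
  assumes v: "0 \<le> v" and "splitting v u n a b" "splitting v u m c d"
  shows "a \<le> c"
proof -
  have s: "u = a + b" "u = c + d" "0 \<le> a" "0 \<le> b" "0 \<le> c" "0 \<le> d" "inf d v = 0"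
    "a \<le> real n *\<^sub>R v"
    using assms by (auto simp: splitting_def)
  have "inf d (real n *\<^sub>R v) = 0"
    using s v by (intro disjoint_scaleR) auto
  then have "inf d a = 0"
    using s by (intro disjoint_mono[of d "real n *\<^sub>R v" a]) auto
  have "a \<le> c + d"
    using s by (metis le_add_same_cancel1)
  then have "a = inf (c + d) a"
    by (simp add: inf_absorb2)
  also have "\<dots> \<le> inf c a + inf d a"
    using s by (intro inf_add_le)
  also have "\<dots> \<le> c"
    using \<open>inf d a = 0\<close> by simp
  finally show ?thesis .
qed

lemma splitting_unique:
  fixes v :: "'a::vector_lattice"
  assumes "0 \<le> v" "splitting v u n a b" "splitting v u m c d"
  shows "a = c"
  using splitting_le assms by (blast intro: antisym)

lemma splitting_add:
  fixes v :: "'a::vector_lattice"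
  assumes "0 \<le> v" "splitting v u n a b" "splitting v w m c d"
  shows "splitting v (u + w) (n + m) (a + c) (b + d)"
  using assms unfolding splitting_def
  by (auto simp: scaleR_left_distrib intro!: disjoint_add add_mono)

section \<open>Additive functions on the positive cone\<close>

text \<open>Additivity gives homogeneity for natural factors and, with nonnegativity, monotonicity.
  Sandwiching \<open>n * r\<close> between consecutive naturals bounds \<open>n\<close> times the
  error by \<open>G u\<close> for every \<open>n\<close>, so the error is zero.\<close>

lemma additive_cone_scaleR:
  fixes G :: "'a::vector_lattice \<Rightarrow> real"
  assumes add: "\<And>u w. 0 \<le> u \<Longrightarrow> 0 \<le> w \<Longrightarrow> G (u + w) = G u + G w"
    and nonneg: "\<And>u. 0 \<le> u \<Longrightarrow> 0 \<le> G u"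
    and u: "0 \<le> u" and r: "0 \<le> r"
  shows "G (r *\<^sub>R u) = r * G u"
proof -
  have nat: "G (real n *\<^sub>R w) = real n * G w" if "0 \<le> w" for n w
  proof (induction n)
    case 0
    then show ?case using add[of 0 0] by simp
  next
    case (Suc n)
    then show ?case
      using add[of w "real n *\<^sub>R w"] that
      by (simp add: scaleR_left_distrib scaleR_nonneg_nonneg algebra_simps)
  qed
  have mono: "G x \<le> G y" if "0 \<le> x" "x \<le> y" for x y
    using add[of x "y - x"] nonneg[of "y - x"] that by simp
  have close: "real n * \<bar>G (r *\<^sub>R u) - r * G u\<bar> \<le> G u" for n :: nat
  proof -
    define k where "k = nat \<lfloor>real n * r\<rfloor>"
    have k: "real k \<le> real n * r" "real n * r \<le> real (Suc k)"
      using r unfolding k_def by (auto simp: of_nat_nat) linarith+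
    have ru: "0 \<le> r *\<^sub>R u"
      using u r by (simp add: scaleR_nonneg_nonneg)
    have "G (real k *\<^sub>R u) \<le> G (real n *\<^sub>R (r *\<^sub>R u))"
      using k u by (intro mono) (auto simp: scaleR_right_mono scaleR_nonneg_nonneg)
    then have lower: "real k * G u \<le> real n * G (r *\<^sub>R u)"
      using nat[OF u] nat[OF ru] by simp
    have "G (real n *\<^sub>R (r *\<^sub>R u)) \<le> G (real (Suc k) *\<^sub>R u)"
      using k u r by (intro mono) (auto simp: scaleR_right_mono scaleR_nonneg_nonneg simp del: of_nat_Suc)
    then have upper: "real n * G (r *\<^sub>R u) \<le> real (Suc k) * G u"
      using nat[OF u] nat[OF ru] by metis
    have "real k * G u \<le> (real n * r) * G u" "(real n * r) * G u \<le> real (Suc k) * G u"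
      using k nonneg[OF u] by (auto intro!: mult_right_mono simp del: of_nat_Suc)
    then have "\<bar>real n * G (r *\<^sub>R u) - real n * r * G u\<bar> \<le> G u"
      using lower upper by (simp add: algebra_simps abs_le_iff)
    moreover have "real n * G (r *\<^sub>R u) - real n * r * G u = real n * (G (r *\<^sub>R u) - r * G u)"
      by (simp add: algebra_simps)
    ultimately show ?thesis
      by (simp add: abs_mult)
  qed
  show ?thesis
  proof (rule ccontr)
    assume "G (r *\<^sub>R u) \<noteq> r * G u"
    then have "0 < \<bar>G (r *\<^sub>R u) - r * G u\<bar>"
      by simp
    then obtain n :: nat where "G u < real n * \<bar>G (r *\<^sub>R u) - r * G u\<bar>"
      using reals_Archimedean3 by blast
    then show False
      using close[of n] by simp
  qed
qed

lemma additive_cone_extends: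
  fixes G :: "'a::vector_lattice \<Rightarrow> real"
  assumes add: "\<And>u w. 0 \<le> u \<Longrightarrow> 0 \<le> w \<Longrightarrow> G (u + w) = G u + G w"
    and nonneg: "\<And>u. 0 \<le> u \<Longrightarrow> 0 \<le> G u"
  obtains f where "positive_functional f" "\<And>u. 0 \<le> u \<Longrightarrow> f u = G u"
proof -
  define f where "f u = G (sup u 0) - G (sup (- u) 0)" for u
  \<comment> \<open>The value does not depend on how an element is written as a difference of
    nonnegative ones, so linearity can be checked on any convenient representation.\<close>
  have f_diff: "f (x - y) = G x - G y" if "0 \<le> x" "0 \<le> y" for x y
  proof -
    have "x + t = y + s" if "s - t = x - y" for s t
      using that by (simp add: algebra_simps)
    \<comment> \<open>Rearranging the two differences into an equality of sums keeps every term in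
      the cone, where \<open>G\<close> is additive.\<close>
    from this[OF sup_0_minus_eq] have "x + sup (- (x - y)) 0 = y + sup (x - y) 0" .
    then have "G x + G (sup (- (x - y)) 0) = G y + G (sup (x - y) 0)"
      using that by (metis add sup_ge2)
    then show ?thesis
      by (simp add: f_def)
  qed
  have f_eq: "f u = G u" if "0 \<le> u" for u
    using f_diff[of u 0] that add[of 0 0] by simp
  have split: "\<exists>x y. 0 \<le> x \<and> 0 \<le> y \<and> u = x - y" for u :: 'a
    by (metis sup_0_minus_eq sup_ge2)
  have "linear f"
  proof (rule linearI)
    fix a b :: 'a
    obtain x y x' y' where *: "0 \<le> x" "0 \<le> y" "a = x - y" "0 \<le> x'" "0 \<le> y'" "b = x' - y'"
      using split[of a] split[of b] by blast
    have "a + b = (x + x') - (y + y')"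
      using * by simp
    then have "f (a + b) = G (x + x') - G (y + y')"
      using * by (simp only: f_diff add_nonneg_nonneg)
    then show "f (a + b) = f a + f b"
      using * by (simp add: add f_diff)
  next
    fix r :: real and a :: 'a
    obtain x y where *: "0 \<le> x" "0 \<le> y" "a = x - y"
      using split[of a] by blast
    note hom = additive_cone_scaleR[of G, OF add nonneg]
    show "f (r *\<^sub>R a) = r *\<^sub>R f a"
    proof (cases "0 \<le> r")
      case True
      have "r *\<^sub>R a = r *\<^sub>R x - r *\<^sub>R y"
        using * by (simp add: scaleR_right_diff_distrib)
      then have "f (r *\<^sub>R a) = G (r *\<^sub>R x) - G (r *\<^sub>R y)"
        using * True by (simp only: f_diff scaleR_nonneg_nonneg)
      also have "\<dots> = r * (G x - G y)"
        using * True by (simp add: hom right_diff_distrib)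
      finally show ?thesis
        using * by (simp add: f_diff)
    next
      case False
      then have "0 \<le> - r"
        by simp
      \<comment> \<open>For negative \<open>r\<close> the roles of \<open>x\<close> and
        \<open>y\<close> are exchanged, so that only the nonnegative factor \<open>- r\<close>
        occurs.\<close>
      have "r *\<^sub>R a = (- r) *\<^sub>R y - (- r) *\<^sub>R x"
        using * by (simp add: scaleR_right_diff_distrib)
      then have "f (r *\<^sub>R a) = G ((- r) *\<^sub>R y) - G ((- r) *\<^sub>R x)"
        using * \<open>0 \<le> - r\<close> by (simp only: f_diff scaleR_nonneg_nonneg)
      also have "\<dots> = (- r) * G y - (- r) * G x"
        using * \<open>0 \<le> - r\<close> by (simp only: hom)
      also have "\<dots> = r * (G x - G y)"
        by (simp add: right_diff_distrib)
      finally show ?thesis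
        using * by (simp add: f_diff)
    qed
  qed
  then have "positive_functional f"
    using f_eq nonneg by (simp add: positive_functional_def)
  then show thesis
    using f_eq by (rule that)
qed

section \<open>The canonical extension\<close>

text \<open>The functional is built in three stages: \<open>g n\<close> stretches \<open>P\<close>
  from the interval up to \<open>v\<close> to the one up to \<open>n\<close> times \<open>v\<close>,
  \<open>G\<close> applies it to the dominated part of a splitting, and \<open>f\<close> extends
  \<open>G\<close> linearly.\<close>

lemma canonical_functional_exists:
  fixes P :: "'a::vector_lattice \<Rightarrow> 'a \<Rightarrow> real"
  assumes hyp: "hyper_archimedean TYPE('a)" and P: "conditional_mean P"
    and v: "0 \<le> v" "v \<noteq> 0"
  obtains f where "canonical_functional P v f"
proof -
  have P_nonneg: "0 \<le> P u v" if "0 \<le> u" "u \<le> v" for u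
    using P that v by (simp add: conditional_mean_def)
  have P_add: "P (u + w) v = P u v + P w v" if "0 \<le> u" "0 \<le> w" "u + w \<le> v" for u w
    using P that v by (simp add: conditional_mean_def)
  define g where "g n a = real n * P ((1 / real n) *\<^sub>R a) v" for n :: nat and a
  have scaled: "(1 / real n) *\<^sub>R a \<le> v" if "a \<le> real n *\<^sub>R v" "0 < n" for a and n :: nat
    using scaleR_left_mono[OF that(1), of "1 / real n"] that(2) by simp
  have P_nat: "P (real k *\<^sub>R a) v = real k * P a v" if "0 \<le> a" "real k *\<^sub>R a \<le> v" for k a
    using that
  proof (induction k)
    case 0
    then show ?case using P_add[of 0 0] v by simp
  next
    case (Suc k)
    have "a + real k *\<^sub>R a \<le> v"
      using Suc.prems by (simp add: scaleR_left_distrib)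
    moreover from this have "real k *\<^sub>R a \<le> v"
      using Suc.prems by (meson le_add_same_cancel2 order_trans)
    ultimately show ?case
      using Suc P_add[of a "real k *\<^sub>R a"]
      by (simp add: scaleR_left_distrib scaleR_nonneg_nonneg algebra_simps)
  qed
  have g_mult: "g (m * n) a = g n a" if "0 \<le> a" "a \<le> real n *\<^sub>R v" "0 < n" "0 < m" for a m n
  proof -
    have "real m *\<^sub>R ((1 / real (m * n)) *\<^sub>R a) = (1 / real n) *\<^sub>R a"
      using that by simp
    then have "P ((1 / real n) *\<^sub>R a) v = real m * P ((1 / real (m * n)) *\<^sub>R a) v"
      using P_nat[of "(1 / real (m * n)) *\<^sub>R a" m] scaled[of a n] that
      by (simp add: scaleR_nonneg_nonneg)
    then show ?thesis
      by (simp add: g_def)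
  qed
  \<comment> \<open>Both values agree with the one at the common index \<open>m * n\<close>.\<close>
  have g_indep: "g m a = g n a"
    if "0 \<le> a" "a \<le> real n *\<^sub>R v" "0 < n" "a \<le> real m *\<^sub>R v" "0 < m" for a m n
    using that g_mult[of a n m] g_mult[of a m n] by (simp add: mult.commute)
  have g_add: "g n (a + c) = g n a + g n c"
    if "0 \<le> a" "0 \<le> c" "a + c \<le> real n *\<^sub>R v" "0 < n" for a c n
    using P_add[of "(1 / real n) *\<^sub>R a" "(1 / real n) *\<^sub>R c"] scaled[of "a + c" n] that
    by (simp add: g_def scaleR_right_distrib scaleR_nonneg_nonneg algebra_simps)
  \<comment> \<open>The choice is harmless: the dominated part is unique by
    \<open>splitting_unique\<close>, and its value does not depend on the index by
    \<open>g_indep\<close>.\<close>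
  define G where "G u = (SOME y. \<exists>n a b. splitting v u n a b \<and> y = g n a)" for u
  have G_eq: "G u = g n a" if s: "splitting v u n a b" for u n a b
    unfolding G_def
  proof (rule some_equality)
    show "\<exists>n' a' b'. splitting v u n' a' b' \<and> g n a = g n' a'"
      using s by blast
  next
    fix y assume "\<exists>m c d. splitting v u m c d \<and> y = g m c"
    then obtain m c d where t: "splitting v u m c d" "y = g m c"
      by blast
    have "c = a"
      using splitting_unique[OF v(1) t(1) s] .
    then show "y = g n a"
      using s t by (auto simp: splitting_def intro: g_indep)
  qed
  have G_add: "G (u + w) = G u + G w" if uw: "0 \<le> u" "0 \<le> w" for u w
  proof -
    obtain n a b where s: "splitting v u n a b"
      using splitting_exists[OF hyp uw(1) v(1)] .
    obtain m c d where t: "splitting v w m c d"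
      using splitting_exists[OF hyp uw(2) v(1)] .
    have st: "splitting v (u + w) (n + m) (a + c) (b + d)"
      using splitting_add[OF v(1) s t] .
    \<comment> \<open>\<open>g_add\<close> works at a single index, so both dominated parts are
      moved to the index \<open>n + m\<close> of the sum and then back.\<close>
    have le: "a \<le> real (n + m) *\<^sub>R v" "c \<le> real (n + m) *\<^sub>R v"
      using s t v scaleR_right_mono[of "real n" "real (n + m)" v]
        scaleR_right_mono[of "real m" "real (n + m)" v]
      by (auto simp: splitting_def simp del: of_nat_add intro: order_trans)
    have "G (u + w) = g (n + m) a + g (n + m) c"
      using G_eq[OF st] st s t by (simp add: splitting_def g_add)
    also have "g (n + m) a = g n a"
      using le s by (intro g_indep) (auto simp: splitting_def)
    also have "g (n + m) c = g m c"
      using le t by (intro g_indep) (auto simp: splitting_def)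
    finally show ?thesis
      using G_eq[OF s] G_eq[OF t] by simp
  qed
  have G_nonneg: "0 \<le> G u" if u: "0 \<le> u" for u
  proof -
    obtain n a b where s: "splitting v u n a b"
      using splitting_exists[OF hyp u v(1)] .
    then have "0 \<le> g n a"
      unfolding g_def using scaled[of a n] P_nonneg[of "(1 / real n) *\<^sub>R a"]
      by (simp add: splitting_def scaleR_nonneg_nonneg)
    then show ?thesis
      using G_eq[OF s] by simp
  qed
  obtain f where f: "positive_functional f" and f_G: "\<And>u. 0 \<le> u \<Longrightarrow> f u = G u"
    using additive_cone_extends[of G, OF G_add G_nonneg] by metis
  have lin: "linear f"
    using f by (simp add: positive_functional_def)
  have f_P: "f u = P u v" if "0 \<le> u" "u \<le> v" for u
  proof -
    have "splitting v u 1 u 0"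
      using that v by (simp add: splitting_def inf_absorb1)
    then show ?thesis
      using G_eq f_G that by (simp add: g_def)
  qed
  have f_disjoint: "f u = 0" if "0 \<le> u" "inf u v = 0" for u
  proof -
    \<comment> \<open>The dominated part is 0, and additivity at \<open>0 + 0\<close> forces
      \<open>P 0 v\<close> to vanish.\<close>
    have "splitting v u 1 0 u"
      using that v by (simp add: splitting_def)
    then have "f u = P 0 v"
      using G_eq f_G that by (simp add: g_def)
    then show ?thesis
      using P_add[of 0 0] v by simp
  qed
  have "f u = 0" if u: "inf \<bar>u\<bar> v = 0" for u
  proof -
    \<comment> \<open>Taking \<open>w\<close> to be \<open>u\<close> and \<open>- u\<close> covers
      the positive and negative parts of an element of arbitrary sign; both inherit disjointness
      from its modulus.\<close>
    have "f (sup w 0) = 0" if "w \<le> \<bar>u\<bar>" for w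
    proof -
      have "inf v \<bar>u\<bar> = 0"
        using u by (metis inf_commute)
      then have "inf v (sup w 0) = 0"
        by (rule disjoint_mono) (use v that in simp_all)
      then have "inf (sup w 0) v = 0"
        by (metis inf_commute)
      then show ?thesis
        by (intro f_disjoint) simp_all
    qed
    then have "f (sup u 0) = 0" "f (sup (- u) 0) = 0"
      using abs_ge_self[of u] abs_ge_minus_self[of u] by blast+
    then show ?thesis
      using linear_diff[OF lin, of "sup u 0" "sup (- u) 0"] by (simp only: sup_0_minus_eq)
  qed
  then have "canonical_functional P v f"
    using f f_P by (simp add: canonical_functional_def)
  then show thesis
    by (rule that)
qed

text \<open>A splitting writes a nonnegative \<open>u\<close> as \<open>n\<close> times an element
  between 0 and \<open>v\<close>, where the value is prescribed by \<open>P\<close>, plus an element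
  on which both functionals vanish. Agreement on the cone suffices by linearity.\<close>

lemma canonical_functional_unique:
  fixes P :: "'a::vector_lattice \<Rightarrow> 'a \<Rightarrow> real"
  assumes hyp: "hyper_archimedean TYPE('a)" and v: "0 \<le> v"
    and f: "canonical_functional P v f" and h: "canonical_functional P v h"
  shows "f = h"
proof
  fix u
  have lin: "linear f" "linear h"
    using f h by (auto simp: canonical_functional_def positive_functional_def)
  have cone: "f u = h u" if u: "0 \<le> u" for u
  proof -
    obtain n a b where s: "splitting v u n a b"
      using splitting_exists[OF hyp u v] .
    define c where "c = (1 / real n) *\<^sub>R a"
    have "a = real n *\<^sub>R c" "0 \<le> c" "c \<le> v"
      using s scaleR_left_mono[of a "real n *\<^sub>R v" "1 / real n"]
      by (auto simp: c_def splitting_def scaleR_nonneg_nonneg)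
    then have "u = real n *\<^sub>R c + b" "f c = h c" "f b = 0" "h b = 0"
      using s f h by (auto simp: canonical_functional_def splitting_def)
    then show ?thesis
      using lin by (simp add: linear_add linear_scale)
  qed
  have "k u = k (sup u 0) - k (sup (- u) 0)" if "linear k" for k :: "'a \<Rightarrow> real"
    using linear_diff[OF that] sup_0_minus_eq by metis
  then show "f u = h u"
    using lin cone by (metis sup_ge2)
qed

lemma canonical_extension_canonical:
  fixes P :: "'a::vector_lattice \<Rightarrow> 'a \<Rightarrow> real"
  assumes hyp: "hyper_archimedean TYPE('a)" and P: "conditional_mean P"
    and v: "0 \<le> v" "v \<noteq> 0"
  shows "\<exists>!f. canonical_functional P v f"
    and "canonical_functional P v (\<lambda>u. canonical_extension P u v)"
proof -
  show ex1: "\<exists>!f. canonical_functional P v f"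
    using canonical_functional_exists[OF assms] canonical_functional_unique[OF hyp v(1)] by metis
  show "canonical_functional P v (\<lambda>u. canonical_extension P u v)"
    using theI'[OF ex1] by (simp add: canonical_extension_def)
qed

text \<open>The indicator of \<open>A\<close> is that of \<open>A \<inter> B\<close> plus that of
  \<open>A - B\<close>; the latter is disjoint from the indicator of \<open>B\<close>, so the
  canonical functional kills it.\<close>

lemma canonical_extension_step_indicator:
  fixes M :: "'x step_fun \<Rightarrow> 'x step_fun \<Rightarrow> real"
  assumes M: "conditional_mean M" and B: "B \<noteq> {}"
  shows "canonical_extension M (step_indicator A) (step_indicator B) =
         canonical_extension M (step_indicator (A \<inter> B)) (step_indicator B)"
proof -
  let ?f = "\<lambda>u. canonical_extension M u (step_indicator B)"
  have "0 \<le> step_indicator B"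
    by transfer simp
  moreover have "step_indicator B \<noteq> 0"
    using B by transfer (auto simp: fun_eq_iff)
  ultimately have f: "canonical_functional M (step_indicator B) ?f"
    using canonical_extension_canonical(2)[OF hyper_archimedean_step_fun M] by blast
  have "step_indicator A = step_indicator (A \<inter> B) + step_indicator (A - B)"
    by transfer (auto simp: fun_eq_iff)
  moreover have "inf \<bar>step_indicator (A - B)\<bar> (step_indicator B) = 0"
    by transfer (auto simp: fun_eq_iff)
  then have "?f (step_indicator (A - B)) = 0"
    using f by (simp add: canonical_functional_def)
  moreover have "linear ?f"
    using f by (simp add: canonical_functional_def positive_functional_def)
  ultimately show ?thesis
    by (simp add: linear_add[of ?f])
qed

theorem proposition10:
  fixes P :: "'a::vector_lattice \<Rightarrow> 'a \<Rightarrow> real"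
    and M :: "'x step_fun \<Rightarrow> 'x step_fun \<Rightarrow> real"
    and A B :: "'x set"
  shows "(hyper_archimedean TYPE('a) \<and> conditional_mean P \<longrightarrow>
           (\<forall>v. 0 \<le> v \<and> v \<noteq> 0 \<longrightarrow>
              (\<exists>!f. canonical_functional P v f) \<and>
              (\<forall>u. 0 \<le> u \<and> u \<le> v \<longrightarrow> canonical_extension P u v = P u v) \<and>
              positive_functional (\<lambda>u. canonical_extension P u v))) \<and>
         (conditional_mean M \<and> A \<noteq> {} \<and> B \<noteq> {} \<longrightarrow>
            canonical_extension M (step_indicator A) (step_indicator B) =
            canonical_extension M (step_indicator (A \<inter> B)) (step_indicator B))"
proof (intro conjI impI allI; (elim conjE)?)
  fix v :: 'a
  assume hyp: "hyper_archimedean TYPE('a)" "conditional_mean P" and v: "0 \<le> v" "v \<noteq> 0"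
  note ext = canonical_extension_canonical[OF hyp v]
  show "\<exists>!f. canonical_functional P v f"
    by (rule ext(1))
  show "canonical_extension P u v = P u v" if "0 \<le> u" "u \<le> v" for u
    using ext(2) that by (simp add: canonical_functional_def)
  show "positive_functional (\<lambda>u. canonical_extension P u v)"
    using ext(2) by (simp add: canonical_functional_def)
next
  assume "conditional_mean M" "B \<noteq> {}"
  then show "canonical_extension M (step_indicator A) (step_indicator B) =
      canonical_extension M (step_indicator (A \<inter> B)) (step_indicator B)"
    by (rule canonical_extension_step_indicator)
qed

end
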